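(* Let $\Omega=\Omega_1\times\Omega_2\subset\mathbb{R}^2$ be a bounded rectangular domain, and let $f$ be the solution of the truncated Kolmogorov equation $$\partial_t f=v\,\partial_x f+\partial_v^2 f\ \text{ in }(0,\infty)\times\Omega,\qquad f=0\ \text{ on }(0,\infty)\times\partial\Omega,\qquad f=f_0\ \text{ on }\{0\}\times\Omega .$$ Then, for every $t>0$, $$\|f(t)\|_{L^2(\Omega)}\leq e^{-\frac{2t}{|\Omega_1|^2}}\,\|f_0\|_{L^2(\Omega)} .$$
   Context: Points of $\Omega$ are written $(v,x)$ with $v\in\Omega_1$, $x\in\Omega_2$, where $\Omega_1,\Omega_2$ are bounded open intervals and $|\Omega_1|$ is the length of $\Omega_1$. Here $f(t)=f(t,\cdot,\cdot)$. *)

theory Defs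
  imports "HOL-Analysis.Analysis"
begin

definition in_L2 :: "(real \<times> real) set \<Rightarrow> (real \<times> real \<Rightarrow> real) \<Rightarrow> bool" where
  "in_L2 S g \<longleftrightarrow> g \<in> borel_measurable (lebesgue_on S) \<and>
                integrable (lebesgue_on S) (\<lambda>z. (g z)\<^sup>2)"

definition norm_L2 :: "(real \<times> real) set \<Rightarrow> (real \<times> real \<Rightarrow> real) \<Rightarrow> real" where
  "norm_L2 S g = sqrt (integral\<^sup>L (lebesgue_on S) (\<lambda>z. (g z)\<^sup>2))"

definition rect :: "real \<Rightarrow> real \<Rightarrow> real \<Rightarrow> real \<Rightarrow> (real \<times> real) set" where
  "rect a b c d = {a<..<b} \<times> {c<..<d}"

(* The sides on which the characteristics x' = -v of the transport part f_t = v f_x leave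
   the rectangle. *)
definition outflow :: "real \<Rightarrow> real \<Rightarrow> real \<Rightarrow> real \<Rightarrow> (real \<times> real) set" where
  "outflow a b c d =
     {(v, x). v \<in> {a<..<b} \<and> ((x = c \<and> v > 0) \<or> (x = d \<and> v < 0))}"

(* f_t = v f_x + f_vv classically in (0,oo) x Omega. *)
definition kolmogorov_eq_on :: "(real \<times> real) set \<Rightarrow> (real \<Rightarrow> real \<times> real \<Rightarrow> real) \<Rightarrow> bool" where
  "kolmogorov_eq_on \<Omega> f \<longleftrightarrow>
     (\<exists>ft fx fv fvv :: real \<Rightarrow> real \<times> real \<Rightarrow> real.
        (\<forall>g \<in> {ft, fx, fv, fvv}. continuous_on ({0<..} \<times> \<Omega>) (\<lambda>(t, z). g t z)) \<and>
        (\<forall>t>0. \<forall>(v, x) \<in> \<Omega>.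
           ((\<lambda>s. f s (v, x)) has_real_derivative ft t (v, x)) (at t) \<and>
           ((\<lambda>y. f t (v, y)) has_real_derivative fx t (v, x)) (at x) \<and>
           ((\<lambda>w. f t (w, x)) has_real_derivative fv t (v, x)) (at v) \<and>
           ((\<lambda>w. fv t (w, x)) has_real_derivative fvv t (v, x)) (at v) \<and>
           ft t (v, x) = v * fx t (v, x) + fvv t (v, x)))"

(* The condition f = 0 on the boundary is attained continuously at every boundary point except
   on the outflow sides. There the first-order degenerate operator admits no boundary data
   (Fichera): asking for continuity up to those sides as well would leave only f = 0. Any f that
   is continuous on (0,oo) x closure Omega and vanishes on the whole boundary is in particular
   covered. *)
definition zero_boundary ::
    "real \<Rightarrow> real \<Rightarrow> real \<Rightarrow> real \<Rightarrow> (real \<Rightarrow> real \<times> real \<Rightarrow> real) \<Rightarrow> bool" where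
  "zero_boundary a b c d f \<longleftrightarrow>
     (\<forall>t>0. \<forall>z \<in> frontier (rect a b c d). f t z = 0) \<and>
     continuous_on ({0<..} \<times> (closure (rect a b c d) - outflow a b c d)) (\<lambda>(t, z). f t z)"

(* For data in L2 the initial value is attained in the L2 sense. *)
definition initial_value ::
    "(real \<times> real) set \<Rightarrow> (real \<times> real \<Rightarrow> real) \<Rightarrow> (real \<Rightarrow> real \<times> real \<Rightarrow> real) \<Rightarrow> bool" where
  "initial_value \<Omega> f0 f \<longleftrightarrow>
     (\<forall>z \<in> \<Omega>. f 0 z = f0 z) \<and>
     (\<forall>t\<ge>0. in_L2 \<Omega> (f t)) \<and>
     ((\<lambda>t. norm_L2 \<Omega> (\<lambda>z. f t z - f 0 z)) \<longlongrightarrow> 0) (at_right 0)"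

definition truncated_kolmogorov_solution ::
    "real \<Rightarrow> real \<Rightarrow> real \<Rightarrow> real \<Rightarrow> (real \<times> real \<Rightarrow> real) \<Rightarrow> (real \<Rightarrow> real \<times> real \<Rightarrow> real) \<Rightarrow> bool"
  where
  "truncated_kolmogorov_solution a b c d f0 f \<longleftrightarrow>
     kolmogorov_eq_on (rect a b c d) f \<and>
     zero_boundary a b c d f \<and>
     initial_value (rect a b c d) f0 f"

end

theory Submission imports Defs begin

text \<open>
The formal energy argument multiplies the equation by \<open>f\<close> and integrates: transport contributes a
boundary term of good sign, diffusion contributes minus the squared norm of \<open>f\<^sub>v\<close>, and an elementary
Poincare inequality in \<open>v\<close> on an interval of length \<open>L\<close> gives
\<open>(\<parallel>f\<parallel>\<^sup>2)' \<le> - (4 / L\<^sup>2) * \<parallel>f\<parallel>\<^sup>2\<close>. For a classical solution this is not directly available: the derivatives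
are controlled only inside the open rectangle, and near the outflow sides \<open>f\<close> is not even known to be
bounded.

Both obstacles disappear when \<open>f\<^sup>2\<close> is replaced by \<open>trunc \<kappa> f\<close>, a smooth function of \<open>f\<close> that vanishes
for \<open>f\<^sup>2 \<le> \<kappa>\<close>. By compactness, \<open>f\<^sup>2 \<le> \<kappa>\<close> holds in a neighbourhood of the boundary minus the
outflow sides (\<open>small_near_boundary\<close>), so on a slightly smaller closed rectangle, where all derivatives
are continuous, the boundary terms either vanish or have the right sign (\<open>box_energy_decay\<close>).

The Poincare inequality is built into the flux. For a function \<open>r\<close> of \<open>v\<close>,
subtracting \<open>2 * r * trunc \<kappa> f\<close> from the diffusive flux turns the dissipation estimate into a pointwise inequality
(\<open>energy_flux_inequality\<close>), which requires \<open>r' + 2 * r\<^sup>2 \<le> - 2 / L\<^sup>2\<close> and the discriminant condition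
\<open>\<eta>'\<^sup>2 \<le> 4 * \<eta> * \<eta>''\<close> for the truncation \<open>\<eta>\<close> (\<open>trunc_discriminant\<close>). For the exact
square, \<open>r' + r\<^sup>2 \<le> - 2 / L\<^sup>2\<close> and \<open>\<eta>'\<^sup>2 \<le> 2 * \<eta> * \<eta>''\<close> would be the matching pair; trading a
stronger condition on \<open>r\<close> for a weaker one on \<open>\<eta>\<close> accommodates the truncation, and it is affordable because the interval has a Poincare constant much better than the one needed.

Letting the rectangle grow and \<open>\<kappa>\<close> tend to zero gives decay between any two positive times
(\<open>energy_decay_positive_times\<close>); letting the earlier time tend to zero brings in the initial datum.
\<close>

section \<open>A smooth truncation of the square\<close>

lemma DERIV_max_power:
  "((\<lambda>y::real. max 0 y ^ (n + 2)) has_real_derivative real (n + 2) * max 0 y ^ (n + 1)) (at y)"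
proof -
  consider "y < 0" | "y > 0" | "y = 0" by linarith
  then show ?thesis
  proof cases
    case 1
    have "((\<lambda>y::real. 0) has_real_derivative 0) (at y)" by simp
    then have "((\<lambda>y::real. max 0 y ^ (n + 2)) has_real_derivative 0) (at y)"
      by (rule has_field_derivative_transform_within_open[where S = "{..<0}"]) (use 1 in auto)
    then show ?thesis using 1 by simp
  next
    case 2
    have "((\<lambda>y::real. y ^ (n + 2)) has_real_derivative real (n + 2) * y ^ (n + 1)) (at y)"
      using DERIV_pow[of "n + 2" y] by simp
    then have "((\<lambda>y::real. max 0 y ^ (n + 2)) has_real_derivative real (n + 2) * y ^ (n + 1)) (at y)"
      by (rule has_field_derivative_transform_within_open[where S = "{0<..}"]) (use 2 in auto)
    then show ?thesis using 2 by simp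
  next
    case 3
    have "((\<lambda>h::real. max 0 h ^ (n + 1)) \<longlongrightarrow> 0) (at 0)"
      by (auto intro!: tendsto_eq_intros)
    then have "((\<lambda>h::real. max 0 h ^ (n + 2) / h) \<longlongrightarrow> 0) (at 0)"
      by (rule Lim_transform_eventually) (auto simp: eventually_at_filter max_def)
    then show ?thesis using 3 by (simp add: DERIV_def)
  qed
qed

text \<open>A twice continuously differentiable replacement for \<open>s\<^sup>2\<close> that vanishes for \<open>s\<^sup>2 \<le> \<kappa>\<close>. The third
power makes the second derivative continuous at the threshold; the denominator restores quadratic
growth with leading coefficient one.\<close>

definition trunc :: "real \<Rightarrow> real \<Rightarrow> real" where
  "trunc \<kappa> s = max 0 (s\<^sup>2 - \<kappa>) ^ 3 / (s\<^sup>2 + \<kappa>) ^ 2"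

definition trunc1 :: "real \<Rightarrow> real \<Rightarrow> real" where
  "trunc1 \<kappa> s = 2 * s * (3 * max 0 (s\<^sup>2 - \<kappa>) ^ 2 / (s\<^sup>2 + \<kappa>) ^ 2
     - 2 * max 0 (s\<^sup>2 - \<kappa>) ^ 3 / (s\<^sup>2 + \<kappa>) ^ 3)"

definition trunc2 :: "real \<Rightarrow> real \<Rightarrow> real" where
  "trunc2 \<kappa> s = 2 * (3 * max 0 (s\<^sup>2 - \<kappa>) ^ 2 / (s\<^sup>2 + \<kappa>) ^ 2
       - 2 * max 0 (s\<^sup>2 - \<kappa>) ^ 3 / (s\<^sup>2 + \<kappa>) ^ 3)
     + 4 * s\<^sup>2 * (6 * max 0 (s\<^sup>2 - \<kappa>) / (s\<^sup>2 + \<kappa>) ^ 2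
       - 12 * max 0 (s\<^sup>2 - \<kappa>) ^ 2 / (s\<^sup>2 + \<kappa>) ^ 3
       + 6 * max 0 (s\<^sup>2 - \<kappa>) ^ 3 / (s\<^sup>2 + \<kappa>) ^ 4)"

lemma DERIV_max_square:
  assumes "(g has_real_derivative g') (at s)"
  shows "((\<lambda>s. max 0 (g s) ^ 2) has_real_derivative 2 * max 0 (g s) * g') (at s)"
  using DERIV_chain2[OF DERIV_max_power[of 0] assms] by (simp add: power2_eq_square)

lemma DERIV_max_cube:
  assumes "(g has_real_derivative g') (at s)"
  shows "((\<lambda>s. max 0 (g s) ^ 3) has_real_derivative 3 * max 0 (g s) ^ 2 * g') (at s)"
  using DERIV_chain2[OF DERIV_max_power[of 1] assms] by (simp add: numeral_3_eq_3 numeral_2_eq_2)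

lemma DERIV_trunc:
  assumes "\<kappa> > 0"
  shows "(trunc \<kappa> has_real_derivative trunc1 \<kappa> s) (at s)"
proof -
  define P where "P = max 0 (s\<^sup>2 - \<kappa>)"
  define D where "D = s\<^sup>2 + \<kappa>"
  have D: "D \<noteq> 0" using assms unfolding D_def by (smt (verit) zero_le_power2)
  have p: "((\<lambda>s. max 0 (s\<^sup>2 - \<kappa>) ^ 3) has_real_derivative 3 * P\<^sup>2 * (2 * s)) (at s)"
    unfolding P_def by (intro DERIV_max_cube) (auto intro!: derivative_eq_intros)
  have d: "((\<lambda>s. (s\<^sup>2 + \<kappa>)\<^sup>2) has_real_derivative 2 * D * (2 * s)) (at s)"
    unfolding D_def by (auto intro!: derivative_eq_intros)
  have "(3 * P\<^sup>2 * (2 * s) * D\<^sup>2 - P ^ 3 * (2 * D * (2 * s))) / (D\<^sup>2 * D\<^sup>2)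
      = 2 * s * (3 * P\<^sup>2 / D\<^sup>2 - 2 * P ^ 3 / D ^ 3)"
    using D by (simp add: field_simps eval_nat_numeral)
  then show ?thesis
    using DERIV_divide[OF p d] D unfolding trunc_def[abs_def] trunc1_def P_def D_def by simp
qed

lemma DERIV_trunc1:
  assumes "\<kappa> > 0"
  shows "(trunc1 \<kappa> has_real_derivative trunc2 \<kappa> s) (at s)"
proof -
  define P where "P = max 0 (s\<^sup>2 - \<kappa>)"
  define D where "D = s\<^sup>2 + \<kappa>"
  have D: "D \<noteq> 0" using assms unfolding D_def by (smt (verit) zero_le_power2)
  have p2: "((\<lambda>s. 3 * max 0 (s\<^sup>2 - \<kappa>) ^ 2) has_real_derivative 3 * (2 * P * (2 * s))) (at s)"
    unfolding P_def by (intro DERIV_cmult DERIV_max_square) (auto intro!: derivative_eq_intros)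
  have p3: "((\<lambda>s. 2 * max 0 (s\<^sup>2 - \<kappa>) ^ 3) has_real_derivative 2 * (3 * P\<^sup>2 * (2 * s))) (at s)"
    unfolding P_def by (intro DERIV_cmult DERIV_max_cube) (auto intro!: derivative_eq_intros)
  have d2: "((\<lambda>s. (s\<^sup>2 + \<kappa>) ^ 2) has_real_derivative 2 * D * (2 * s)) (at s)"
    unfolding D_def by (auto intro!: derivative_eq_intros)
  have d3: "((\<lambda>s. (s\<^sup>2 + \<kappa>) ^ 3) has_real_derivative 3 * D\<^sup>2 * (2 * s)) (at s)"
    unfolding D_def by (auto intro!: derivative_eq_intros)
  have l: "((\<lambda>s. 2 * s) has_real_derivative 2) (at s)"
    by (auto intro!: derivative_eq_intros)
  have q2: "((\<lambda>s. 3 * max 0 (s\<^sup>2 - \<kappa>) ^ 2 / (s\<^sup>2 + \<kappa>) ^ 2) has_real_derivative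
      (3 * (2 * P * (2 * s)) * D\<^sup>2 - 3 * P\<^sup>2 * (2 * D * (2 * s))) / (D\<^sup>2 * D\<^sup>2)) (at s)"
    using DERIV_divide[OF p2 d2] D unfolding P_def D_def by simp
  have q3: "((\<lambda>s. 2 * max 0 (s\<^sup>2 - \<kappa>) ^ 3 / (s\<^sup>2 + \<kappa>) ^ 3) has_real_derivative
      (2 * (3 * P\<^sup>2 * (2 * s)) * D ^ 3 - 2 * P ^ 3 * (3 * D\<^sup>2 * (2 * s))) / (D ^ 3 * D ^ 3)) (at s)"
    using DERIV_divide[OF p3 d3] D unfolding P_def D_def by simp
  have "(3 * (2 * P * (2 * s)) * D\<^sup>2 - 3 * P\<^sup>2 * (2 * D * (2 * s))) / (D\<^sup>2 * D\<^sup>2)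
      = s * (12 * P / D\<^sup>2 - 12 * P\<^sup>2 / D ^ 3)"
    "(2 * (3 * P\<^sup>2 * (2 * s)) * D ^ 3 - 2 * P ^ 3 * (3 * D\<^sup>2 * (2 * s))) / (D ^ 3 * D ^ 3)
      = s * (12 * P\<^sup>2 / D ^ 3 - 12 * P ^ 3 / D ^ 4)"
    using D by (simp_all add: field_simps eval_nat_numeral)
  note q = q2[unfolded this(1)] q3[unfolded this(2)]
  have "2 * (3 * P\<^sup>2 / D\<^sup>2 - 2 * P ^ 3 / D ^ 3)
       + (s * (12 * P / D\<^sup>2 - 12 * P\<^sup>2 / D ^ 3) - s * (12 * P\<^sup>2 / D ^ 3 - 12 * P ^ 3 / D ^ 4)) * (2 * s)
     = trunc2 \<kappa> s"
    unfolding trunc2_def P_def[symmetric] D_def[symmetric]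
    by (simp add: algebra_simps power2_eq_square)
  then show ?thesis
    using DERIV_mult[OF l DERIV_diff[OF q]] unfolding trunc1_def[abs_def]
    by (simp add: P_def D_def)
qed

lemma trunc_zero:
  assumes "s\<^sup>2 \<le> \<kappa>"
  shows "trunc \<kappa> s = 0" "trunc1 \<kappa> s = 0" "trunc2 \<kappa> s = 0"
  using assms by (auto simp: trunc_def trunc1_def trunc2_def)

lemma trunc_nonneg: "trunc \<kappa> s \<ge> 0"
  by (simp add: trunc_def)

lemma trunc_le:
  assumes "\<kappa> > 0"
  shows "trunc \<kappa> s \<le> s\<^sup>2"
proof -
  have D: "s\<^sup>2 + \<kappa> > 0" using assms by (smt (verit) zero_le_power2)
  have "max 0 (s\<^sup>2 - \<kappa>) ^ 3 = max 0 (s\<^sup>2 - \<kappa>) * max 0 (s\<^sup>2 - \<kappa>) ^ 2"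
    by (simp add: eval_nat_numeral)
  also have "\<dots> \<le> s\<^sup>2 * (s\<^sup>2 + \<kappa>) ^ 2"
    using assms by (intro mult_mono power_mono) auto
  finally show ?thesis using D by (simp add: trunc_def divide_simps)
qed

lemma continuous_on_trunc [continuous_intros]:
  assumes "\<kappa> > 0" "continuous_on A g"
  shows "continuous_on A (\<lambda>z. trunc \<kappa> (g z))" "continuous_on A (\<lambda>z. trunc1 \<kappa> (g z))"
    "continuous_on A (\<lambda>z. trunc2 \<kappa> (g z))"
proof -
  have D: "(g z)\<^sup>2 + \<kappa> \<noteq> 0" for z using assms by (smt (verit) zero_le_power2)
  show "continuous_on A (\<lambda>z. trunc \<kappa> (g z))" "continuous_on A (\<lambda>z. trunc1 \<kappa> (g z))"
    "continuous_on A (\<lambda>z. trunc2 \<kappa> (g z))"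
    unfolding trunc_def trunc1_def trunc2_def
    by (intro continuous_intros assms; simp add: D)+
qed

text \<open>Above the threshold the truncation is \<open>\<phi> (s\<^sup>2)\<close> with \<open>\<phi> q = (q - \<kappa>)^3 / (q + \<kappa>)\<^sup>2\<close>; both \<open>\<phi>'\<close> and
\<open>\<phi>''\<close> factor into visibly nonnegative terms.\<close>

lemma trunc_eqs:
  assumes "\<kappa> > 0" "s\<^sup>2 > \<kappa>"
  shows "trunc1 \<kappa> s = 2 * s * ((s\<^sup>2 - \<kappa>)^2 * (s\<^sup>2 + 5 * \<kappa>) / (s\<^sup>2 + \<kappa>)^3)"
    "trunc2 \<kappa> s = 2 * ((s\<^sup>2 - \<kappa>)^2 * (s\<^sup>2 + 5 * \<kappa>) / (s\<^sup>2 + \<kappa>)^3)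
        + 4 * s\<^sup>2 * (24 * \<kappa>\<^sup>2 * (s\<^sup>2 - \<kappa>) / (s\<^sup>2 + \<kappa>)^4)"
proof -
  define q where "q = s\<^sup>2"
  have D: "q + \<kappa> \<noteq> 0" and P: "max 0 (q - \<kappa>) = q - \<kappa>" using assms by (auto simp: q_def)
  have 1: "3 * (q - \<kappa>) ^ 2 / (q + \<kappa>) ^ 2 - 2 * (q - \<kappa>) ^ 3 / (q + \<kappa>) ^ 3
      = (q - \<kappa>)^2 * (q + 5 * \<kappa>) / (q + \<kappa>)^3"
    using D by (simp add: divide_simps, algebra)
  have 2: "6 * (q - \<kappa>) / (q + \<kappa>) ^ 2 - 12 * (q - \<kappa>) ^ 2 / (q + \<kappa>) ^ 3
       + 6 * (q - \<kappa>) ^ 3 / (q + \<kappa>) ^ 4 = 24 * \<kappa>\<^sup>2 * (q - \<kappa>) / (q + \<kappa>)^4"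
    using D by (simp add: divide_simps, algebra)
  show "trunc1 \<kappa> s = 2 * s * ((s\<^sup>2 - \<kappa>)^2 * (s\<^sup>2 + 5 * \<kappa>) / (s\<^sup>2 + \<kappa>)^3)"
    unfolding trunc1_def q_def[symmetric] P 1 ..
  show "trunc2 \<kappa> s = 2 * ((s\<^sup>2 - \<kappa>)^2 * (s\<^sup>2 + 5 * \<kappa>) / (s\<^sup>2 + \<kappa>)^3)
        + 4 * s\<^sup>2 * (24 * \<kappa>\<^sup>2 * (s\<^sup>2 - \<kappa>) / (s\<^sup>2 + \<kappa>)^4)"
    unfolding trunc2_def q_def[symmetric] P 1 2 ..
qed

lemma trunc2_nonneg:
  assumes "\<kappa> > 0"
  shows "trunc2 \<kappa> s \<ge> 0"
proof (cases "s\<^sup>2 > \<kappa>")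
  case True
  then show ?thesis using assms by (simp add: trunc_eqs)
qed (simp add: trunc_zero)

text \<open>For \<open>s\<^sup>2\<close> in place of the truncation the factor 2 would suffice, with equality. The factor 4 leaves room
for the defect of the truncation at moderate values above its threshold.\<close>

lemma trunc_discriminant:
  assumes "\<kappa> > 0"
  shows "(trunc1 \<kappa> s)\<^sup>2 \<le> 4 * trunc \<kappa> s * trunc2 \<kappa> s"
proof (cases "s\<^sup>2 > \<kappa>")
  case True
  define q where "q = s\<^sup>2"
  have q: "q > \<kappa>" using True by (simp add: q_def)
  have D: "q + \<kappa> > 0" using q assms by simp
  have P: "max 0 (q - \<kappa>) = q - \<kappa>" using q by simp
  have "4 * trunc \<kappa> s * trunc2 \<kappa> s - (trunc1 \<kappa> s)\<^sup>2
      = 4 * (q - \<kappa>)^4 / (q + \<kappa>)^6 * (q^3 + 69 * \<kappa>\<^sup>2 * q - 10 * \<kappa>^3)"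
    unfolding trunc_eqs[OF assms True] trunc_def power_mult_distrib q_def[symmetric] P
    using D by (simp add: divide_simps, algebra)
  moreover have "q^3 + 69 * \<kappa>\<^sup>2 * q - 10 * \<kappa>^3 \<ge> 0"
  proof -
    have "\<kappa>\<^sup>2 * \<kappa> \<le> \<kappa>\<^sup>2 * q" using q by (intro mult_left_mono) auto
    moreover have "q^3 \<ge> 0" "\<kappa>^3 \<ge> 0" using q assms by simp_all
    ultimately show ?thesis by (simp add: eval_nat_numeral)
  qed
  ultimately have "4 * trunc \<kappa> s * trunc2 \<kappa> s - (trunc1 \<kappa> s)\<^sup>2 \<ge> 0"
    using D by simp
  then show ?thesis by simp
qed (simp add: trunc_zero)

text \<open>Nonnegativity of a quadratic form in \<open>p\<close> and \<open>r\<close>, by the discriminant condition on the truncation.\<close>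

lemma trunc_quadratic:
  assumes "\<kappa> > 0"
  shows "trunc2 \<kappa> s * p\<^sup>2 - 2 * r * trunc1 \<kappa> s * p + 4 * r\<^sup>2 * trunc \<kappa> s \<ge> 0"
proof (cases "trunc2 \<kappa> s = 0")
  case True
  then have "trunc1 \<kappa> s = 0" using trunc_discriminant[OF assms, of s] by simp
  then show ?thesis using True trunc_nonneg[of \<kappa> s] by simp
next
  case False
  then have pos: "trunc2 \<kappa> s > 0" using trunc2_nonneg[OF assms, of s] by simp
  have "trunc2 \<kappa> s * (trunc2 \<kappa> s * p\<^sup>2 - 2 * r * trunc1 \<kappa> s * p + 4 * r\<^sup>2 * trunc \<kappa> s)
     = (trunc2 \<kappa> s * p - r * trunc1 \<kappa> s)\<^sup>2
       + r\<^sup>2 * (4 * trunc \<kappa> s * trunc2 \<kappa> s - (trunc1 \<kappa> s)\<^sup>2)" by algebra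
  also have "\<dots> \<ge> 0" using trunc_discriminant[OF assms, of s] by simp
  finally show ?thesis using pos by (simp add: zero_le_mult_iff)
qed

lemma trunc_tendsto:
  "((\<lambda>n. trunc (1 / real (Suc n)) s) \<longlongrightarrow> s\<^sup>2) sequentially"
proof (cases "s = 0")
  case False
  have l: "(\<lambda>n. 1 / real (Suc n)) \<longlonglongrightarrow> 0" by (rule LIMSEQ_Suc[OF lim_1_over_n])
  have "(\<lambda>n. trunc (1 / real (Suc n)) s) \<longlonglongrightarrow> max 0 (s\<^sup>2 - 0) ^ 3 / (s\<^sup>2 + 0) ^ 2"
    unfolding trunc_def using False by (intro tendsto_intros l) auto
  also have "max 0 (s\<^sup>2 - 0) ^ 3 / (s\<^sup>2 + 0) ^ 2 = s\<^sup>2" using False by (simp add: eval_nat_numeral)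
  finally show ?thesis .
qed (simp add: trunc_zero)

section \<open>The energy inequality on compact sub-rectangles\<close>

text \<open>This is half the logarithmic derivative of \<open>\<phi> v = 1 - 2 * (v - m)\<^sup>2 / L\<^sup>2\<close>, which is positive on an
interval of length \<open>L\<close> centred at \<open>m\<close>. With \<open>r = \<phi>' / (2 * \<phi>)\<close> one has
\<open>r' + 2 * r\<^sup>2 = \<phi>'' / (2 * \<phi>) \<le> - 2 / L\<^sup>2\<close>, which is where the decay rate comes from.\<close>

definition drift :: "real \<Rightarrow> real \<Rightarrow> real \<Rightarrow> real" where
  "drift L m v = - 2 * (v - m) / (L\<^sup>2 - 2 * (v - m)\<^sup>2)"

lemma drift_denominator_pos:
  fixes L m v :: real
  assumes "L > 0" "\<bar>v - m\<bar> \<le> L / 2"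
  shows "L\<^sup>2 - 2 * (v - m)\<^sup>2 > 0"
proof -
  have "\<bar>v - m\<bar>\<^sup>2 \<le> (L / 2)\<^sup>2" using assms by (intro power_mono) auto
  then have "2 * (v - m)\<^sup>2 \<le> L\<^sup>2 / 2" by (simp add: power_divide)
  moreover have "L\<^sup>2 > 0" using assms by simp
  ultimately show ?thesis by linarith
qed

lemma DERIV_drift:
  assumes "L > 0" "\<bar>v - m\<bar> \<le> L / 2"
  shows "(drift L m has_real_derivative
     - 2 / (L\<^sup>2 - 2 * (v - m)\<^sup>2) - 2 * (drift L m v)\<^sup>2) (at v)"
proof -
  define y where "y = v - m"
  define N where "N = L\<^sup>2 - 2 * (v - m)\<^sup>2"
  have N: "N > 0" using drift_denominator_pos[OF assms] by (simp add: N_def)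
  have n: "((\<lambda>v. - 2 * (v - m)) has_real_derivative -2) (at v)"
    by (auto intro!: derivative_eq_intros)
  have d: "((\<lambda>v. L\<^sup>2 - 2 * (v - m)\<^sup>2) has_real_derivative - 4 * y) (at v)"
    unfolding y_def by (auto intro!: derivative_eq_intros)
  have "(drift L m has_real_derivative (- 2 * N - - 2 * y * (- 4 * y)) / (N * N)) (at v)"
    using DERIV_divide[OF n d] N unfolding drift_def[abs_def] y_def N_def by simp
  moreover have "(- 2 * N - - 2 * y * (- 4 * y)) / (N * N) = - 2 / N - 2 * (- 2 * y / N)\<^sup>2"
    using N by (simp add: diff_divide_distrib power2_eq_square)
  ultimately show ?thesis by (simp add: drift_def y_def N_def)
qed

text \<open>With \<open>s = f\<close>, \<open>p = f\<^sub>v\<close> and \<open>q = f\<^sub>v\<^sub>v\<close>, and apart from the transport term, the left side is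
\<open>exp (- k t)\<close> times the time derivative of \<open>exp (k t) * trunc \<kappa> f\<close> for \<open>k = 4 / L\<^sup>2\<close>, and the right
side is the \<open>v\<close>-derivative of the flux \<open>trunc1 \<kappa> f * f\<^sub>v - 2 * drift * trunc \<kappa> f\<close>. The drift part of
the flux replaces the Poincare inequality.\<close>

lemma energy_flux_inequality:
  assumes "\<kappa> > 0" "L > 0" "\<bar>v - m\<bar> \<le> L / 2"
  shows "4 / L\<^sup>2 * trunc \<kappa> s + trunc1 \<kappa> s * q \<le>
    trunc2 \<kappa> s * p * p + trunc1 \<kappa> s * q
     - 2 * ((- 2 / (L\<^sup>2 - 2 * (v - m)\<^sup>2) - 2 * (drift L m v)\<^sup>2) * trunc \<kappa> s + trunc1 \<kappa> s * p * drift L m v)"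
proof -
  define r where "r = drift L m v"
  define N where "N = L\<^sup>2 - 2 * (v - m)\<^sup>2"
  have N: "N > 0" using drift_denominator_pos[OF assms(2,3)] by (simp add: N_def)
  define c where "c = 2 / N"
  have "4 / L\<^sup>2 \<le> 4 / N"
    using N assms(2) by (intro divide_left_mono mult_pos_pos) (auto simp: N_def)
  then have "4 / L\<^sup>2 * trunc \<kappa> s \<le> 4 / N * trunc \<kappa> s"
    using trunc_nonneg by (rule mult_right_mono)
  then have "4 / L\<^sup>2 * trunc \<kappa> s \<le> 2 * c * trunc \<kappa> s" by (simp add: c_def)
  moreover have "trunc2 \<kappa> s * p\<^sup>2 - 2 * r * trunc1 \<kappa> s * p + 4 * r\<^sup>2 * trunc \<kappa> s \<ge> 0"
    by (rule trunc_quadratic[OF assms(1)])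
  moreover have "trunc2 \<kappa> s * p * p + trunc1 \<kappa> s * q
      - 2 * ((- c - 2 * r\<^sup>2) * trunc \<kappa> s + trunc1 \<kappa> s * p * r)
    = trunc1 \<kappa> s * q + 2 * c * trunc \<kappa> s
      + (trunc2 \<kappa> s * p\<^sup>2 - 2 * r * trunc1 \<kappa> s * p + 4 * r\<^sup>2 * trunc \<kappa> s)"
    by algebra
  ultimately have "4 / L\<^sup>2 * trunc \<kappa> s + trunc1 \<kappa> s * q \<le> trunc2 \<kappa> s * p * p + trunc1 \<kappa> s * q
      - 2 * ((- c - 2 * r\<^sup>2) * trunc \<kappa> s + trunc1 \<kappa> s * p * r)" by linarith
  moreover have "- c = - 2 / N" by (simp add: c_def)
  ultimately show ?thesis by (simp only: r_def N_def)
qed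

lemma integral_x_derivative:
  fixes G G' :: "real \<times> real \<Rightarrow> real"
  assumes "A \<le> B" "C \<le> D"
    and cont: "continuous_on (cbox (A, C) (B, D)) G'"
    and der: "\<And>v x. A \<le> v \<Longrightarrow> v \<le> B \<Longrightarrow> C \<le> x \<Longrightarrow> x \<le> D \<Longrightarrow>
      ((\<lambda>y. G (v, y)) has_real_derivative G' (v, x)) (at x)"
    and bd: "\<And>v. A \<le> v \<Longrightarrow> v \<le> B \<Longrightarrow> G (v, D) \<le> G (v, C)"
  shows "integral (cbox (A, C) (B, D)) G' \<le> 0"
proof -
  have i: "((\<lambda>x. G' (v, x)) has_integral (G (v, D) - G (v, C))) (cbox C D)"
    if "v \<in> cbox A B" for v
    unfolding box_real using that assms(2)
    by (intro fundamental_theorem_of_calculus)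
      (auto simp: has_real_derivative_iff_has_vector_derivative[symmetric]
        intro!: has_field_derivative_at_within[OF der])
  have "integral (cbox (A, C) (B, D)) G'
      = integral (cbox A B) (\<lambda>v. integral (cbox C D) (\<lambda>x. G' (v, x)))"
    by (rule integral_prod_continuous[OF cont])
  also have "\<dots> = integral (cbox A B) (\<lambda>v. G (v, D) - G (v, C))"
    by (intro integral_cong integral_unique i)
  also have "\<dots> \<le> 0"
  proof (cases "(\<lambda>v. G (v, D) - G (v, C)) integrable_on cbox A B")
    case True
    from integral_le[OF True integrable_0] bd show ?thesis by simp
  qed (simp add: not_integrable_integral)
  finally show ?thesis .
qed

lemma integral_v_derivative:
  fixes G G' :: "real \<times> real \<Rightarrow> real"
  assumes "A \<le> B" "C \<le> D"
    and cont: "continuous_on (cbox (A, C) (B, D)) G'"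
    and der: "\<And>v x. A \<le> v \<Longrightarrow> v \<le> B \<Longrightarrow> C \<le> x \<Longrightarrow> x \<le> D \<Longrightarrow>
      ((\<lambda>w. G (w, x)) has_real_derivative G' (v, x)) (at v)"
    and bd: "\<And>x. C \<le> x \<Longrightarrow> x \<le> D \<Longrightarrow> G (B, x) = G (A, x)"
  shows "integral (cbox (A, C) (B, D)) G' = 0"
proof -
  have i: "((\<lambda>v. G' (v, x)) has_integral (G (B, x) - G (A, x))) (cbox A B)"
    if "x \<in> cbox C D" for x
    unfolding box_real using that assms(1)
    by (intro fundamental_theorem_of_calculus)
      (auto simp: has_real_derivative_iff_has_vector_derivative[symmetric]
        intro!: has_field_derivative_at_within[OF der])
  have "integral (cbox (A, C) (B, D)) G'
      = integral (cbox A B) (\<lambda>v. integral (cbox C D) (\<lambda>x. G' (v, x)))"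
    by (rule integral_prod_continuous[OF cont])
  also have "\<dots> = integral (cbox C D) (\<lambda>x. integral (cbox A B) (\<lambda>v. G' (v, x)))"
    using integral_swap_continuous[of A C B D "\<lambda>v x. G' (v, x)"] cont by simp
  also have "\<dots> = integral (cbox C D) (\<lambda>x. G (B, x) - G (A, x))"
    by (intro integral_cong integral_unique i)
  also have "\<dots> = integral (cbox C D) (\<lambda>x. 0)"
    using bd by (intro integral_cong) auto
  finally show ?thesis by simp
qed

text \<open>Integrating the pointwise inequality over the rectangle leaves only boundary terms. Those in \<open>v\<close>
vanish because the truncation and its derivative vanish where \<open>f\<^sup>2 \<le> \<kappa>\<close>. Those in \<open>x\<close> are
\<open>v * trunc \<kappa> f\<close> at the top minus the same at the bottom: on the inflow parts they vanish, and on the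
outflow parts they have the favourable sign, whatever \<open>f\<close> does there.\<close>

lemma box_energy_decay:
  fixes f ft fx fv fvv :: "real \<Rightarrow> real \<times> real \<Rightarrow> real"
  assumes Q: "Q = cbox (A, C) (B, D)" and \<kappa>: "\<kappa> > 0" and L: "L > 0" and AB: "A \<le> B" "C \<le> D" and st: "0 < s" "s \<le> t"
    and Lm: "\<And>v. A \<le> v \<Longrightarrow> v \<le> B \<Longrightarrow> \<bar>v - m\<bar> \<le> L / 2"
    and cont: "\<And>g. g \<in> {ft, fx, fv, fvv} \<Longrightarrow>
      continuous_on ({0<..} \<times> Q) (\<lambda>(t, z). g t z)"
    and contf: "continuous_on ({0<..} \<times> Q) (\<lambda>(t, z). f t z)"
    and dt: "\<And>t v x. t > 0 \<Longrightarrow> (v, x) \<in> Q \<Longrightarrow>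
      ((\<lambda>s. f s (v, x)) has_real_derivative ft t (v, x)) (at t)"
    and dx: "\<And>t v x. t > 0 \<Longrightarrow> (v, x) \<in> Q \<Longrightarrow>
      ((\<lambda>y. f t (v, y)) has_real_derivative fx t (v, x)) (at x)"
    and dv: "\<And>t v x. t > 0 \<Longrightarrow> (v, x) \<in> Q \<Longrightarrow>
      ((\<lambda>w. f t (w, x)) has_real_derivative fv t (v, x)) (at v)"
    and dvv: "\<And>t v x. t > 0 \<Longrightarrow> (v, x) \<in> Q \<Longrightarrow>
      ((\<lambda>w. fv t (w, x)) has_real_derivative fvv t (v, x)) (at v)"
    and eq: "\<And>t v x. t > 0 \<Longrightarrow> (v, x) \<in> Q \<Longrightarrow>
      ft t (v, x) = v * fx t (v, x) + fvv t (v, x)"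
    and left: "\<And>\<tau> x. s \<le> \<tau> \<Longrightarrow> \<tau> \<le> t \<Longrightarrow> C \<le> x \<Longrightarrow> x \<le> D \<Longrightarrow> (f \<tau> (A, x))\<^sup>2 \<le> \<kappa>"
    and right: "\<And>\<tau> x. s \<le> \<tau> \<Longrightarrow> \<tau> \<le> t \<Longrightarrow> C \<le> x \<Longrightarrow> x \<le> D \<Longrightarrow> (f \<tau> (B, x))\<^sup>2 \<le> \<kappa>"
    and bottom: "\<And>\<tau> v. s \<le> \<tau> \<Longrightarrow> \<tau> \<le> t \<Longrightarrow> A \<le> v \<Longrightarrow> v \<le> B \<Longrightarrow> v \<le> 0 \<Longrightarrow> (f \<tau> (v, C))\<^sup>2 \<le> \<kappa>"
    and top: "\<And>\<tau> v. s \<le> \<tau> \<Longrightarrow> \<tau> \<le> t \<Longrightarrow> A \<le> v \<Longrightarrow> v \<le> B \<Longrightarrow> v \<ge> 0 \<Longrightarrow> (f \<tau> (v, D))\<^sup>2 \<le> \<kappa>"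
  shows "exp (4 / L\<^sup>2 * t) * integral (Q) (\<lambda>z. trunc \<kappa> (f t z))
    \<le> exp (4 / L\<^sup>2 * s) * integral (Q) (\<lambda>z. trunc \<kappa> (f s z))"
proof -
  define k where "k = 4 / L\<^sup>2"
  define E where "E = (\<lambda>t z. exp (k * t) * trunc \<kappa> (f t z))"
  define Et where "Et = (\<lambda>t z. exp (k * t) * (k * trunc \<kappa> (f t z) + trunc1 \<kappa> (f t z) * ft t z))"
  define Gx where "Gx = (\<lambda>t (z::real\<times>real). fst z * trunc \<kappa> (f t z))"
  define Gx' where "Gx' = (\<lambda>t (z::real\<times>real). fst z * (trunc1 \<kappa> (f t z) * fx t z))"
  define Gv where "Gv = (\<lambda>t (z::real\<times>real). trunc1 \<kappa> (f t z) * fv t z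
      - 2 * (drift L m (fst z) * trunc \<kappa> (f t z)))"
  define Gv' where "Gv' = (\<lambda>t (z::real\<times>real).
     trunc2 \<kappa> (f t z) * fv t z * fv t z + trunc1 \<kappa> (f t z) * fvv t z
     - 2 * ((- 2 / (L\<^sup>2 - 2 * (fst z - m)\<^sup>2) - 2 * (drift L m (fst z))\<^sup>2) * trunc \<kappa> (f t z)
       + trunc1 \<kappa> (f t z) * fv t z * drift L m (fst z)))"
  have Qm: "(v, x) \<in> Q \<longleftrightarrow> A \<le> v \<and> v \<le> B \<and> C \<le> x \<and> x \<le> D" for v x
    unfolding Q cbox_Pair_eq by simp
  have slice: "continuous_on Q (\<lambda>z. g \<tau> z)"
    if "continuous_on ({0<..} \<times> Q) (\<lambda>(t, z). g t z)" "\<tau> > 0" for \<tau> and g :: "real \<Rightarrow> real \<times> real \<Rightarrow> real"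
  proof -
    have "continuous_on Q ((\<lambda>(t, z). g t z) \<circ> Pair \<tau>)"
      using that(2) by (intro continuous_on_compose continuous_on_subset[OF that(1)])
        (auto intro!: continuous_intros)
    then show ?thesis by (simp add: o_def)
  qed
  have cf: "continuous_on Q (f \<tau>)" and cg: "continuous_on Q (ft \<tau>)" "continuous_on Q (fx \<tau>)"
     "continuous_on Q (fv \<tau>)" "continuous_on Q (fvv \<tau>)" if "\<tau> > 0" for \<tau>
    using slice[of f, OF contf that] slice[of ft, OF cont that] slice[of fx, OF cont that]
      slice[of fv, OF cont that] slice[of fvv, OF cont that] by simp_all
  have cr: "continuous_on Q (\<lambda>z. drift L m (fst z))"
    "continuous_on Q (\<lambda>z. - 2 / (L\<^sup>2 - 2 * (fst z - m)\<^sup>2))"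
  proof -
    have "L\<^sup>2 - 2 * (fst z - m)\<^sup>2 \<noteq> 0" if "z \<in> Q" for z
      using drift_denominator_pos[OF L Lm, of "fst z"] that by (cases z) (auto simp: Qm)
    then show "continuous_on Q (\<lambda>z. drift L m (fst z))"
      "continuous_on Q (\<lambda>z. - 2 / (L\<^sup>2 - 2 * (fst z - m)\<^sup>2))"
      unfolding drift_def by (auto intro!: continuous_intros)
  qed
  have cGx: "continuous_on Q (Gx' \<tau>)" and cGv: "continuous_on Q (Gv' \<tau>)"
    and cE: "continuous_on Q (E \<tau>)" and cEt: "continuous_on Q (Et \<tau>)" if "\<tau> > 0" for \<tau>
    unfolding Gx'_def Gv'_def E_def Et_def
    by (intro continuous_intros \<kappa> cf[OF that] cg[OF that] cr)+
  have contEt: "continuous_on ({s..t} \<times> Q) (\<lambda>(t, z). Et t z)"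
  proof -
    have sub: "{s..t} \<times> Q \<subseteq> {0<..} \<times> Q" using st by auto
    note c = contf[THEN continuous_on_subset, OF sub] cont[of ft, THEN continuous_on_subset, OF _ sub]
    show ?thesis unfolding Et_def using c
      by (auto simp: case_prod_beta' intro!: continuous_intros \<kappa>)
  qed
  have dE: "((\<lambda>\<tau>. E \<tau> z) has_field_derivative Et \<tau> z) (at \<tau> within {s..t})"
    if "\<tau> \<in> {s..t}" "z \<in> Q" for \<tau> z
  proof -
    have 1: "((\<lambda>\<tau>. trunc \<kappa> (f \<tau> z)) has_real_derivative trunc1 \<kappa> (f \<tau> z) * ft \<tau> z) (at \<tau>)"
      using DERIV_chain2[OF DERIV_trunc[OF \<kappa>] dt[of \<tau> "fst z" "snd z"]] that st by simp
    have 2: "((\<lambda>\<tau>. exp (k * \<tau>)) has_real_derivative exp (k * \<tau>) * k) (at \<tau>)"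
      by (auto intro!: derivative_eq_intros)
    show ?thesis unfolding E_def Et_def
      by (rule has_field_derivative_at_within, rule DERIV_cong[OF DERIV_mult[OF 2 1]])
        (simp add: algebra_simps)
  qed
  have dF: "((\<lambda>\<tau>. integral Q (E \<tau>)) has_field_derivative integral Q (Et \<tau>)) (at \<tau> within {s..t})"
    if "\<tau> \<in> {s..t}" for \<tau>
    unfolding Q
    by (rule leibniz_rule_field_derivative[OF _ _ _ that])
      (use dE cE contEt st in \<open>auto simp: Q intro!: integrable_continuous\<close>)
  have neg: "integral Q (Et \<tau>) \<le> 0" if \<tau>: "\<tau> \<in> {s..t}" for \<tau>
  proof -
    have \<tau>0: "\<tau> > 0" using \<tau> st by simp
    have Ix: "integral Q (Gx' \<tau>) \<le> 0"
      unfolding Q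
    proof (rule integral_x_derivative[where G = "Gx \<tau>"])
      show "continuous_on (cbox (A, C) (B, D)) (Gx' \<tau>)" using cGx[OF \<tau>0] by (simp add: Q)
      show "((\<lambda>y. Gx \<tau> (v, y)) has_real_derivative Gx' \<tau> (v, x)) (at x)"
        if "A \<le> v" "v \<le> B" "C \<le> x" "x \<le> D" for v x
        unfolding Gx_def Gx'_def using that
        by (auto intro!: DERIV_cmult DERIV_chain2[OF DERIV_trunc[OF \<kappa>] dx] simp: Qm \<tau>0)
      show "Gx \<tau> (v, D) \<le> Gx \<tau> (v, C)" if v: "A \<le> v" "v \<le> B" for v
      proof (cases "v \<le> 0")
        case True
        then show ?thesis using bottom[of \<tau> v] v \<tau> trunc_nonneg[of \<kappa>]
          by (simp add: Gx_def trunc_zero mult_nonpos_nonneg)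
      next
        case False
        then show ?thesis using top[of \<tau> v] v \<tau> trunc_nonneg[of \<kappa>]
          by (simp add: Gx_def trunc_zero)
      qed
    qed (use AB in auto)
    have Iv: "integral Q (Gv' \<tau>) = 0"
      unfolding Q
    proof (rule integral_v_derivative[where G = "Gv \<tau>"])
      show "continuous_on (cbox (A, C) (B, D)) (Gv' \<tau>)" using cGv[OF \<tau>0] by (simp add: Q)
      show "((\<lambda>w. Gv \<tau> (w, x)) has_real_derivative Gv' \<tau> (v, x)) (at v)"
        if "A \<le> v" "v \<le> B" "C \<le> x" "x \<le> D" for v x
      proof -
        have vx: "(v, x) \<in> Q" using that by (simp add: Qm)
        note t1 = DERIV_chain2[OF DERIV_trunc[OF \<kappa>] dv[OF \<tau>0 vx]]
        note t2 = DERIV_chain2[OF DERIV_trunc1[OF \<kappa>] dv[OF \<tau>0 vx]]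
        note r = DERIV_drift[OF L Lm[OF that(1,2)]]
        show ?thesis unfolding Gv_def Gv'_def fst_conv
          by (rule DERIV_cong[OF DERIV_diff[OF DERIV_mult[OF t2 dvv[OF \<tau>0 vx]]
                DERIV_cmult[OF DERIV_mult[OF r t1]]]])
            (simp add: algebra_simps)
      qed
      show "Gv \<tau> (B, x) = Gv \<tau> (A, x)" if "C \<le> x" "x \<le> D" for x
        using left[of \<tau> x] right[of \<tau> x] that \<tau> by (simp add: Gv_def trunc_zero)
    qed (use AB in auto)
    have pt: "Et \<tau> z \<le> exp (k * \<tau>) * (Gx' \<tau> z + Gv' \<tau> z)" if z: "z \<in> Q" for z
    proof -
      obtain v x where vx: "z = (v, x)" by force
      have "\<bar>v - m\<bar> \<le> L / 2" using z Lm by (simp add: vx Qm)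
      from energy_flux_inequality[OF \<kappa> L this, of "f \<tau> z" "fvv \<tau> z" "fv \<tau> z"]
      have "k * trunc \<kappa> (f \<tau> z) + trunc1 \<kappa> (f \<tau> z) * fvv \<tau> z \<le> Gv' \<tau> z"
        by (simp add: k_def Gv'_def vx)
      moreover have "ft \<tau> z = v * fx \<tau> z + fvv \<tau> z" using eq[OF \<tau>0] z by (simp add: vx)
      ultimately show ?thesis unfolding Et_def
        by (intro mult_left_mono) (auto simp: Gx'_def vx algebra_simps)
    qed
    have iG: "Gx' \<tau> integrable_on Q" "Gv' \<tau> integrable_on Q" "Et \<tau> integrable_on Q"
      using cGx[OF \<tau>0] cGv[OF \<tau>0] cEt[OF \<tau>0] by (auto simp: Q intro: integrable_continuous)
    have "integral Q (Et \<tau>) \<le> integral Q (\<lambda>z. exp (k * \<tau>) * (Gx' \<tau> z + Gv' \<tau> z))"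
      by (intro integral_le pt iG integrable_on_mult_right integrable_add)
    also have "\<dots> = exp (k * \<tau>) * (integral Q (Gx' \<tau>) + integral Q (Gv' \<tau>))"
      using iG by (simp add: integral_add)
    also have "\<dots> \<le> 0" using Ix Iv by (simp add: mult_nonneg_nonpos)
    finally show ?thesis .
  qed
  have "integral Q (E t) \<le> integral Q (E s)"
  proof (rule DERIV_nonpos_imp_decreasing_open[OF st(2)])
    show "continuous_on {s..t} (\<lambda>\<tau>. integral Q (E \<tau>))"
      by (rule DERIV_continuous_on[OF dF])
    show "\<exists>y. ((\<lambda>\<tau>. integral Q (E \<tau>)) has_real_derivative y) (at \<tau>) \<and> y \<le> 0"
      if "s < \<tau>" "\<tau> < t" for \<tau>
      using dF[of \<tau>] neg[of \<tau>] that
      by (auto simp: at_within_interior[of \<tau> "{s..t}"] intro!: exI[of _ "integral Q (Et \<tau>)"])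
  qed
  then show ?thesis by (simp add: E_def k_def)
qed

section \<open>Smallness near the sides that carry the boundary condition\<close>

text \<open>The set \<open>X\<close> may fail to be closed, so \<open>g\<close> need not be uniformly continuous on it; compactness of the
zero set alone provides the uniform distance. This matters because nothing is known about the
solution near the outflow sides.\<close>

lemma small_near_compact_zero_set:
  fixes g :: "'a::metric_space \<Rightarrow> real"
  assumes cont: "continuous_on X g" and "compact C" "C \<subseteq> X"
    and zero: "\<And>y. y \<in> C \<Longrightarrow> g y = 0" and "e > 0"
  shows "\<exists>\<delta>>0. \<forall>c\<in>C. \<forall>y\<in>X. dist c y < \<delta> \<longrightarrow> \<bar>g y\<bar> < e"
proof -
  obtain T where T: "open T" "T \<inter> X = g -` {-e<..<e} \<inter> X"
    using cont unfolding continuous_on_open_invariant by (metis open_greaterThanLessThan)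
  have "C \<subseteq> T" using T(2) zero \<open>C \<subseteq> X\<close> \<open>e > 0\<close> by auto
  then obtain \<delta> where \<delta>: "\<delta> > 0" "(\<Union>c\<in>C. ball c \<delta>) \<subseteq> T"
    using compact_subset_open_imp_ball_epsilon_subset[OF \<open>compact C\<close> T(1)] by metis
  have "\<bar>g y\<bar> < e" if "c \<in> C" "y \<in> X" "dist c y < \<delta>" for c y
  proof -
    have "y \<in> T \<inter> X" using \<delta>(2) that by (meson IntI UN_I mem_ball subsetD)
    then show ?thesis using T(2) by auto
  qed
  then show ?thesis using \<delta>(1) by blast
qed

lemma closure_rect:
  assumes "a < b" "c < d"
  shows "closure (rect a b c d) = {a..b} \<times> {c..d}"
  using assms by (simp add: rect_def closure_Times)

lemma frontier_rect:
  assumes "a < b" "c < d"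
  shows "frontier (rect a b c d) = {a..b} \<times> {c..d} - {a<..<b} \<times> {c<..<d}"
proof -
  have "interior (rect a b c d) = rect a b c d"
    unfolding rect_def by (intro interior_open open_Times) auto
  then show ?thesis using closure_rect[OF assms] by (simp add: frontier_def rect_def)
qed

lemma zero_boundary_continuous_on_rect:
  assumes "a < b" "c < d" "zero_boundary a b c d f"
  shows "continuous_on ({0<..} \<times> rect a b c d) (\<lambda>(t, z). f t z)"
proof (rule continuous_on_subset)
  show "continuous_on ({0<..} \<times> (closure (rect a b c d) - outflow a b c d)) (\<lambda>(t, z). f t z)"
    using assms by (simp add: zero_boundary_def)
  show "{0<..} \<times> rect a b c d \<subseteq> {0<..} \<times> (closure (rect a b c d) - outflow a b c d)"
    unfolding closure_rect[OF assms(1,2)] by (auto simp: rect_def outflow_def)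
qed

lemma small_near_boundary_piece:
  assumes ab: "a < b" "c < d" and zb: "zero_boundary a b c d f" and st: "0 < s"
    and S: "compact S" "S \<subseteq> frontier (rect a b c d) - outflow a b c d" and e: "e > 0"
  shows "\<exists>\<delta>>0. \<forall>\<tau>\<in>{s..t}. \<forall>p\<in>S. \<forall>z\<in>rect a b c d. dist p z < \<delta> \<longrightarrow> \<bar>f \<tau> z\<bar> < e"
proof -
  let ?X = "{0<..} \<times> (closure (rect a b c d) - outflow a b c d)"
  have "\<exists>\<delta>>0. \<forall>c\<in>{s..t} \<times> S. \<forall>y\<in>?X. dist c y < \<delta> \<longrightarrow> \<bar>(\<lambda>(t, z). f t z) y\<bar> < e"
  proof (rule small_near_compact_zero_set)
    show "continuous_on ?X (\<lambda>(t, z). f t z)" using zb by (simp add: zero_boundary_def)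
    show "compact ({s..t} \<times> S)" using S(1) by (intro compact_Times) auto
    show "{s..t} \<times> S \<subseteq> ?X" using S(2) st by (auto simp: frontier_def)
    show "(\<lambda>(t, z). f t z) y = 0" if "y \<in> {s..t} \<times> S" for y
    proof -
      have "0 < fst y" "snd y \<in> frontier (rect a b c d)" using that S(2) st by auto
      then show ?thesis using zb by (simp add: zero_boundary_def case_prod_beta)
    qed
  qed (rule e)
  then obtain \<delta> where \<delta>: "\<delta> > 0"
    "\<And>c y. c \<in> {s..t} \<times> S \<Longrightarrow> y \<in> ?X \<Longrightarrow> dist c y < \<delta> \<Longrightarrow> \<bar>(\<lambda>(t, z). f t z) y\<bar> < e" by blast
  have "\<bar>f \<tau> z\<bar> < e" if "\<tau> \<in> {s..t}" "p \<in> S" "z \<in> rect a b c d" "dist p z < \<delta>" for \<tau> p z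
  proof -
    have "z \<in> closure (rect a b c d) - outflow a b c d"
      using that(3) unfolding closure_rect[OF ab] by (auto simp: rect_def outflow_def)
    then show ?thesis
      using \<delta>(2)[of "(\<tau>, p)" "(\<tau>, z)"] that st by (simp add: dist_Pair_Pair)
  qed
  then show ?thesis using \<delta>(1) by blast
qed

text \<open>The non-outflow part of the boundary is a union of four compact segments. The horizontal ones are
cut at \<open>v = 0\<close>, the end point included, because the outflow sides are open at \<open>v = 0\<close>; one of them is
empty when \<open>v\<close> has constant strict sign on the closed velocity interval.\<close>

lemma small_near_boundary:
  assumes ab: "a < b" "c < d" and zb: "zero_boundary a b c d f" and st: "0 < s" and e: "e > 0"
  obtains \<delta> where "\<delta> > 0"
    "\<And>\<tau> v x. \<tau> \<in> {s..t} \<Longrightarrow> (v, x) \<in> rect a b c d \<Longrightarrow>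
      v < a + \<delta> \<or> v > b - \<delta> \<or> (v \<le> 0 \<and> x < c + \<delta>) \<or> (v \<ge> 0 \<and> x > d - \<delta>) \<Longrightarrow> \<bar>f \<tau> (v, x)\<bar> < e"
proof -
  let ?R = "rect a b c d"
  let ?P = "\<lambda>S \<delta>. \<forall>\<tau>\<in>{s..t}. \<forall>p\<in>S. \<forall>z\<in>?R. dist p z < \<delta> \<longrightarrow> \<bar>f \<tau> z\<bar> < e"
  note piece = small_near_boundary_piece[OF ab zb st _ _ e, of _ t]
  have "\<exists>\<delta>>0. ?P ({a} \<times> {c..d}) \<delta>"
    using ab by (intro piece) (auto intro!: compact_Times simp: frontier_rect outflow_def)
  then obtain \<delta>1 where 1: "\<delta>1 > 0" "?P ({a} \<times> {c..d}) \<delta>1" by blast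
  have "\<exists>\<delta>>0. ?P ({b} \<times> {c..d}) \<delta>"
    using ab by (intro piece) (auto intro!: compact_Times simp: frontier_rect outflow_def)
  then obtain \<delta>2 where 2: "\<delta>2 > 0" "?P ({b} \<times> {c..d}) \<delta>2" by blast
  have "\<exists>\<delta>>0. ?P ({a..min b 0} \<times> {c}) \<delta>"
    using ab by (intro piece) (auto intro!: compact_Times simp: frontier_rect outflow_def)
  then obtain \<delta>3 where 3: "\<delta>3 > 0" "?P ({a..min b 0} \<times> {c}) \<delta>3" by blast
  have "\<exists>\<delta>>0. ?P ({max a 0..b} \<times> {d}) \<delta>"
    using ab by (intro piece) (auto intro!: compact_Times simp: frontier_rect outflow_def)
  then obtain \<delta>4 where 4: "\<delta>4 > 0" "?P ({max a 0..b} \<times> {d}) \<delta>4" by blast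
  define \<delta> where "\<delta> = Min {\<delta>1, \<delta>2, \<delta>3, \<delta>4}"
  have \<delta>: "\<delta> > 0" "\<delta> \<le> \<delta>1" "\<delta> \<le> \<delta>2" "\<delta> \<le> \<delta>3" "\<delta> \<le> \<delta>4"
    using 1(1) 2(1) 3(1) 4(1) by (auto simp: \<delta>_def)
  show ?thesis
  proof (rule that[OF \<delta>(1)])
    fix \<tau> v x
    assume \<tau>: "\<tau> \<in> {s..t}" and vx: "(v, x) \<in> ?R"
      and near: "v < a + \<delta> \<or> v > b - \<delta> \<or> (v \<le> 0 \<and> x < c + \<delta>) \<or> (v \<ge> 0 \<and> x > d - \<delta>)"
    have r: "a < v" "v < b" "c < x" "x < d" using vx by (auto simp: rect_def)
    from near consider "v < a + \<delta>" | "v > b - \<delta>" | "v \<le> 0" "x < c + \<delta>" | "v \<ge> 0" "x > d - \<delta>"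
      by blast
    then show "\<bar>f \<tau> (v, x)\<bar> < e"
    proof cases
      case 1
      then show ?thesis using 1 r \<delta> \<open>?P ({a} \<times> {c..d}) \<delta>1\<close>[rule_format, OF \<tau> _ vx, of "(a, x)"]
        by (simp add: dist_Pair_Pair dist_real_def)
    next
      case 2
      then show ?thesis using r \<delta> \<open>?P ({b} \<times> {c..d}) \<delta>2\<close>[rule_format, OF \<tau> _ vx, of "(b, x)"]
        by (simp add: dist_Pair_Pair dist_real_def)
    next
      case 3
      then show ?thesis
        using r \<delta> \<open>?P ({a..min b 0} \<times> {c}) \<delta>3\<close>[rule_format, OF \<tau> _ vx, of "(v, c)"]
        by (simp add: dist_Pair_Pair dist_real_def)
    next
      case 4
      then show ?thesis
        using r \<delta> \<open>?P ({max a 0..b} \<times> {d}) \<delta>4\<close>[rule_format, OF \<tau> _ vx, of "(v, d)"]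
        by (simp add: dist_Pair_Pair dist_real_def)
    qed
  qed
qed

text \<open>Once the threshold \<open>\<kappa>\<close> is fixed, every sufficiently large sub-rectangle has its left and right sides, and
the inflow parts of its bottom and top sides, in the region where \<open>f\<^sup>2 \<le> \<kappa>\<close>.\<close>

lemma truncated_energy_decay:
  assumes ab: "a < b" "c < d" and keq: "kolmogorov_eq_on (rect a b c d) f"
    and zb: "zero_boundary a b c d f" and st: "0 < s" "s \<le> t" and \<kappa>: "\<kappa> > 0" and n: "\<eta> > 0"
  obtains \<delta> where "0 < \<delta>" "\<delta> < \<eta>"
    "integral (cbox (a + \<delta>, c + \<delta>) (b - \<delta>, d - \<delta>)) (\<lambda>z. trunc \<kappa> (f t z))
      \<le> exp (- (4 / (b - a)\<^sup>2 * (t - s)))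
        * integral (cbox (a + \<delta>, c + \<delta>) (b - \<delta>, d - \<delta>)) (\<lambda>z. trunc \<kappa> (f s z))"
proof -
  let ?R = "rect a b c d"
  obtain \<delta>0 where \<delta>0: "\<delta>0 > 0" and small:
    "\<And>\<tau> v x. \<tau> \<in> {s..t} \<Longrightarrow> (v, x) \<in> ?R \<Longrightarrow>
      v < a + \<delta>0 \<or> v > b - \<delta>0 \<or> (v \<le> 0 \<and> x < c + \<delta>0) \<or> (v \<ge> 0 \<and> x > d - \<delta>0)
      \<Longrightarrow> \<bar>f \<tau> (v, x)\<bar> < sqrt \<kappa>"
    using small_near_boundary[OF ab zb st(1), of "sqrt \<kappa>" t] \<kappa> by (metis real_sqrt_gt_zero)
  have small2: "(f \<tau> (v, x))\<^sup>2 \<le> \<kappa>" if "s \<le> \<tau>" "\<tau> \<le> t" "(v, x) \<in> ?R"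
    "v < a + \<delta>0 \<or> v > b - \<delta>0 \<or> (v \<le> 0 \<and> x < c + \<delta>0) \<or> (v \<ge> 0 \<and> x > d - \<delta>0)" for \<tau> v x
  proof -
    have "\<bar>f \<tau> (v, x)\<bar> \<le> sqrt \<kappa>" using small[of \<tau> v x] that by simp
    then show ?thesis using \<kappa> by (metis power2_abs power_mono abs_ge_zero real_sqrt_pow2 less_imp_le)
  qed
  (* Halving makes the sides of the sub-rectangle lie strictly inside the strips of width \<delta>0. *)
  define \<delta> where "\<delta> = Min {\<delta>0, \<eta>, b - a, d - c} / 2"
  have \<delta>: "0 < \<delta>" "2 * \<delta> \<le> \<delta>0" "2 * \<delta> \<le> \<eta>" "2 * \<delta> \<le> b - a" "2 * \<delta> \<le> d - c"
    using \<delta>0 n ab by (auto simp: \<delta>_def)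
  define Q where "Q = cbox (a + \<delta>, c + \<delta>) (b - \<delta>, d - \<delta>)"
  have QR: "Q \<subseteq> ?R" using \<delta>(1) by (auto simp: Q_def rect_def cbox_Pair_eq)
  have inR: "(v, x) \<in> ?R" if "a + \<delta> \<le> v" "v \<le> b - \<delta>" "c + \<delta> \<le> x" "x \<le> d - \<delta>" for v x
    using that \<delta>(1) by (auto simp: rect_def)
  obtain ft fx fv fvv :: "real \<Rightarrow> real \<times> real \<Rightarrow> real" where
    KE: "(\<forall>g \<in> {ft, fx, fv, fvv}. continuous_on ({0<..} \<times> ?R) (\<lambda>(t, z). g t z)) \<and>
        (\<forall>t>0. \<forall>(v, x) \<in> ?R.
           ((\<lambda>s. f s (v, x)) has_real_derivative ft t (v, x)) (at t) \<and>
           ((\<lambda>y. f t (v, y)) has_real_derivative fx t (v, x)) (at x) \<and>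
           ((\<lambda>w. f t (w, x)) has_real_derivative fv t (v, x)) (at v) \<and>
           ((\<lambda>w. fv t (w, x)) has_real_derivative fvv t (v, x)) (at v) \<and>
           ft t (v, x) = v * fx t (v, x) + fvv t (v, x))"
    using keq unfolding kolmogorov_eq_on_def by (elim exE)
  have cont: "continuous_on ({0<..} \<times> ?R) (\<lambda>(t, z). g t z)" if "g \<in> {ft, fx, fv, fvv}" for g
    using conjunct1[OF KE] that by (rule bspec)
  have D: "((\<lambda>s. f s (v, x)) has_real_derivative ft t (v, x)) (at t)"
    "((\<lambda>y. f t (v, y)) has_real_derivative fx t (v, x)) (at x)"
    "((\<lambda>w. f t (w, x)) has_real_derivative fv t (v, x)) (at v)"
    "((\<lambda>w. fv t (w, x)) has_real_derivative fvv t (v, x)) (at v)"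
    "ft t (v, x) = v * fx t (v, x) + fvv t (v, x)" if "t > 0" "(v, x) \<in> Q" for t v x
    using bspec[OF mp[OF spec[OF conjunct2[OF KE]] that(1)] subsetD[OF QR that(2)]]
    unfolding prod.case by blast+
  have sub: "{0<..} \<times> Q \<subseteq> {0<..} \<times> ?R" using QR by auto
  let ?k = "4 / (b - a)\<^sup>2"
  have *: "exp (?k * t) * integral Q (\<lambda>z. trunc \<kappa> (f t z))
    \<le> exp (?k * s) * integral Q (\<lambda>z. trunc \<kappa> (f s z))"
  proof (rule box_energy_decay[OF Q_def \<kappa> _ _ _ st,
        where m = "(a + b) / 2" and ft = ft and fx = fx and fv = fv and fvv = fvv])
    show "continuous_on ({0<..} \<times> Q) (\<lambda>(t, z). g t z)" if "g \<in> {ft, fx, fv, fvv}" for g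
      by (rule continuous_on_subset[OF cont[OF that] sub])
    show "continuous_on ({0<..} \<times> Q) (\<lambda>(t, z). f t z)"
      by (rule continuous_on_subset[OF zero_boundary_continuous_on_rect[OF ab zb] sub])
    show "\<bar>v - (a + b) / 2\<bar> \<le> (b - a) / 2" if "a + \<delta> \<le> v" "v \<le> b - \<delta>" for v
      using that \<delta>(1) by (simp add: abs_le_iff field_simps)
    show "(f \<tau> (a + \<delta>, x))\<^sup>2 \<le> \<kappa>" if "s \<le> \<tau>" "\<tau> \<le> t" "c + \<delta> \<le> x" "x \<le> d - \<delta>" for \<tau> x
      using that \<delta> by (intro small2 inR) auto
    show "(f \<tau> (b - \<delta>, x))\<^sup>2 \<le> \<kappa>" if "s \<le> \<tau>" "\<tau> \<le> t" "c + \<delta> \<le> x" "x \<le> d - \<delta>" for \<tau> x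
      using that \<delta> by (intro small2 inR) auto
    show "(f \<tau> (v, c + \<delta>))\<^sup>2 \<le> \<kappa>"
      if "s \<le> \<tau>" "\<tau> \<le> t" "a + \<delta> \<le> v" "v \<le> b - \<delta>" "v \<le> 0" for \<tau> v
      using that \<delta> by (intro small2 inR) auto
    show "(f \<tau> (v, d - \<delta>))\<^sup>2 \<le> \<kappa>"
      if "s \<le> \<tau>" "\<tau> \<le> t" "a + \<delta> \<le> v" "v \<le> b - \<delta>" "v \<ge> 0" for \<tau> v
      using that \<delta> by (intro small2 inR) auto
    show "0 < b - a" "a + \<delta> \<le> b - \<delta>" "c + \<delta> \<le> d - \<delta>" using ab \<delta> by auto
  qed (rule D; assumption)+
  have "integral Q (\<lambda>z. trunc \<kappa> (f t z))
      = exp (- (?k * t)) * (exp (?k * t) * integral Q (\<lambda>z. trunc \<kappa> (f t z)))"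
    by (simp add: mult.assoc[symmetric] exp_add[symmetric])
  also have "\<dots> \<le> exp (- (?k * t)) * (exp (?k * s) * integral Q (\<lambda>z. trunc \<kappa> (f s z)))"
    by (intro mult_left_mono *) simp
  also have "\<dots> = exp (- (?k * (t - s))) * integral Q (\<lambda>z. trunc \<kappa> (f s z))"
    by (simp add: mult.assoc[symmetric] exp_add[symmetric] right_diff_distrib del: times_divide_eq_left)
  finally show ?thesis
    using that[of \<delta>] \<delta> n unfolding Q_def by auto
qed

section \<open>Decay of the L2 norm\<close>

lemma in_L2_rect_integral:
  assumes "in_L2 (rect a b c d) g"
  shows "(\<lambda>z. (g z)\<^sup>2) integrable_on rect a b c d"
    "integral\<^sup>L (lebesgue_on (rect a b c d)) (\<lambda>z. (g z)\<^sup>2) = integral (rect a b c d) (\<lambda>z. (g z)\<^sup>2)"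
proof -
  have "open (rect a b c d)" unfolding rect_def by (intro open_Times) auto
  then have "rect a b c d \<in> sets lebesgue" by (simp add: borel_open sets_completionI_sets)
  then show "(\<lambda>z. (g z)\<^sup>2) integrable_on rect a b c d"
    "integral\<^sup>L (lebesgue_on (rect a b c d)) (\<lambda>z. (g z)\<^sup>2) = integral (rect a b c d) (\<lambda>z. (g z)\<^sup>2)"
    using assms by (auto simp: in_L2_def intro: integrable_on_lebesgue_on lebesgue_integral_eq_integral)
qed

text \<open>The truncation threshold and the distance of the sub-rectangle from the boundary go to zero together.
Truncated energies are dominated by \<open>f\<^sup>2\<close>, so square integrability at the two fixed times justifies
the limit.\<close>

lemma energy_decay_positive_times:
  assumes ab: "a < b" "c < d" and keq: "kolmogorov_eq_on (rect a b c d) f"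
    and zb: "zero_boundary a b c d f" and st: "0 < s" "s \<le> t"
    and L2: "in_L2 (rect a b c d) (f s)" "in_L2 (rect a b c d) (f t)"
  shows "integral\<^sup>L (lebesgue_on (rect a b c d)) (\<lambda>z. (f t z)\<^sup>2)
    \<le> exp (- (4 / (b - a)\<^sup>2 * (t - s))) * integral\<^sup>L (lebesgue_on (rect a b c d)) (\<lambda>z. (f s z)\<^sup>2)"
proof -
  let ?R = "rect a b c d"
  let ?c = "exp (- (4 / (b - a)\<^sup>2 * (t - s)))"
  let ?\<kappa> = "\<lambda>n. 1 / real (Suc n)"
  define Q where "Q = (\<lambda>\<delta>. cbox (a + \<delta>, c + \<delta>) (b - \<delta>, d - \<delta>))"
  have "\<exists>\<delta>. 0 < \<delta> \<and> \<delta> < ?\<kappa> n \<and>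
     integral (Q \<delta>) (\<lambda>z. trunc (?\<kappa> n) (f t z)) \<le> ?c * integral (Q \<delta>) (\<lambda>z. trunc (?\<kappa> n) (f s z))" for n
    using truncated_energy_decay[OF ab keq zb st, of "?\<kappa> n" "?\<kappa> n"] unfolding Q_def
    by (metis of_nat_0_less_iff zero_less_Suc zero_less_divide_1_iff)
  then obtain \<delta> where \<delta>: "\<And>n. 0 < \<delta> n" "\<And>n. \<delta> n < ?\<kappa> n"
    and decay: "\<And>n. integral (Q (\<delta> n)) (\<lambda>z. trunc (?\<kappa> n) (f t z))
        \<le> ?c * integral (Q (\<delta> n)) (\<lambda>z. trunc (?\<kappa> n) (f s z))"
    by metis
  have QR: "Q (\<delta> n) \<subseteq> ?R" for n
    using \<delta>(1)[of n] by (auto simp: Q_def rect_def cbox_Pair_eq)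
  have cf: "continuous_on (Q (\<delta> n)) (f \<tau>)" if "\<tau> > 0" for \<tau> n
  proof -
    have "continuous_on (Q (\<delta> n)) ((\<lambda>(t, z). f t z) \<circ> Pair \<tau>)"
      using that QR[of n]
      by (intro continuous_on_compose
          continuous_on_subset[OF zero_boundary_continuous_on_rect[OF ab zb]])
        (auto intro!: continuous_intros)
    then show ?thesis by (simp add: o_def)
  qed
  have iQ: "(\<lambda>z. trunc (?\<kappa> n) (f \<tau> z)) integrable_on Q (\<delta> n)"
    "(\<lambda>z. (f \<tau> z)\<^sup>2) integrable_on Q (\<delta> n)" if "\<tau> > 0" for \<tau> n
    using cf[OF that, of n] unfolding Q_def
    by (auto intro!: integrable_continuous continuous_intros)
  define h where "h = (\<lambda>n z. if z \<in> Q (\<delta> n) then trunc (?\<kappa> n) (f t z) else 0)"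
  have t0: "t > 0" using st by simp
  have Int: "Q (\<delta> n) \<inter> ?R = Q (\<delta> n)" for n using QR[of n] by blast
  have hi: "h n integrable_on ?R" for n
    unfolding h_def integrable_restrict_Int Int using iQ(1)[OF t0] .
  have lim: "(\<lambda>n. integral ?R (h n)) \<longlonglongrightarrow> integral ?R (\<lambda>z. (f t z)\<^sup>2)"
  proof (rule dominated_convergence(2)[OF hi in_L2_rect_integral(1)[OF L2(2)]])
    show "norm (h n z) \<le> (f t z)\<^sup>2" if "z \<in> ?R" for n z
      using trunc_nonneg trunc_le[of "?\<kappa> n"] by (simp add: h_def)
    show "(\<lambda>n. h n z) \<longlonglongrightarrow> (f t z)\<^sup>2" if z: "z \<in> ?R" for z
    proof (rule Lim_transform_eventually[OF trunc_tendsto])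
      obtain v x where vx: "z = (v, x)" by force
      have "\<delta> \<longlonglongrightarrow> 0"
        by (rule tendsto_sandwich[OF _ _ tendsto_const LIMSEQ_Suc[OF lim_1_over_n]])
          (use \<delta> in \<open>auto intro!: always_eventually less_imp_le simp del: of_nat_Suc\<close>)
      moreover have "0 < Min {v - a, b - v, x - c, d - x}"
        using z by (auto simp: vx rect_def)
      ultimately have "\<forall>\<^sub>F n in sequentially. \<delta> n < Min {v - a, b - v, x - c, d - x}"
        by (rule order_tendstoD(2))
      then show "\<forall>\<^sub>F n in sequentially. trunc (?\<kappa> n) (f t z) = h n z"
        by eventually_elim (auto simp: h_def Q_def vx cbox_Pair_eq)
    qed
  qed
  have le: "integral ?R (h n) \<le> ?c * integral ?R (\<lambda>z. (f s z)\<^sup>2)" for n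
  proof -
    have "integral ?R (h n) = integral (Q (\<delta> n)) (\<lambda>z. trunc (?\<kappa> n) (f t z))"
      unfolding h_def Henstock_Kurzweil_Integration.integral_restrict_Int Int ..
    also note decay[of n]
    also have "integral (Q (\<delta> n)) (\<lambda>z. trunc (?\<kappa> n) (f s z)) \<le> integral (Q (\<delta> n)) (\<lambda>z. (f s z)\<^sup>2)"
      by (intro integral_le iQ st trunc_le) simp
    also have "\<dots> \<le> integral ?R (\<lambda>z. (f s z)\<^sup>2)"
      by (intro integral_subset_le QR iQ st in_L2_rect_integral L2) auto
    finally show ?thesis by simp
  qed
  have "integral ?R (\<lambda>z. (f t z)\<^sup>2) \<le> ?c * integral ?R (\<lambda>z. (f s z)\<^sup>2)"
    by (rule LIMSEQ_le_const2[OF lim]) (use le in blast)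
  then show ?thesis by (simp only: in_L2_rect_integral(2)[OF L2(1)] in_L2_rect_integral(2)[OF L2(2)])
qed

lemma square_sum_weighted_le:
  fixes x y \<epsilon> :: real
  assumes "\<epsilon> > 0"
  shows "(x + y)\<^sup>2 \<le> (1 + \<epsilon>) * x\<^sup>2 + (1 + 1 / \<epsilon>) * y\<^sup>2"
proof -
  have "(1 + \<epsilon>) * x\<^sup>2 + (1 + 1 / \<epsilon>) * y\<^sup>2 - (x + y)\<^sup>2 = (\<epsilon> * x - y)\<^sup>2 / \<epsilon>"
    using assms by (simp add: field_simps power2_eq_square)
  also have "\<dots> \<ge> 0" using assms by simp
  finally show ?thesis by simp
qed

text \<open>This plays the part of the triangle inequality in L2, directly for squared norms: the weight
\<open>\<epsilon>\<close> can be sent to zero after the last term has been made to vanish.\<close>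

lemma L2_energy_weighted_le:
  assumes "in_L2 S g" "in_L2 S h" "\<epsilon> > 0"
  shows "integral\<^sup>L (lebesgue_on S) (\<lambda>z. (g z)\<^sup>2)
    \<le> (1 + \<epsilon>) * integral\<^sup>L (lebesgue_on S) (\<lambda>z. (h z)\<^sup>2)
      + (1 + 1 / \<epsilon>) * integral\<^sup>L (lebesgue_on S) (\<lambda>z. (g z - h z)\<^sup>2)"
proof -
  let ?M = "lebesgue_on S"
  have m: "g \<in> borel_measurable ?M" "h \<in> borel_measurable ?M"
    and i: "integrable ?M (\<lambda>z. (g z)\<^sup>2)" "integrable ?M (\<lambda>z. (h z)\<^sup>2)"
    using assms by (auto simp: in_L2_def)
  have id: "integrable ?M (\<lambda>z. (g z - h z)\<^sup>2)"
  proof (rule Bochner_Integration.integrable_bound)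
    show "integrable ?M (\<lambda>z. 2 * (g z)\<^sup>2 + 2 * (h z)\<^sup>2)" using i by simp
    show "(\<lambda>z. (g z - h z)\<^sup>2) \<in> borel_measurable ?M" using m by measurable
    have "(g z - h z)\<^sup>2 \<le> 2 * (g z)\<^sup>2 + 2 * (h z)\<^sup>2" for z
      using square_sum_weighted_le[of 1 "g z" "- h z"] by simp
    then show "AE z in ?M. norm ((g z - h z)\<^sup>2) \<le> norm (2 * (g z)\<^sup>2 + 2 * (h z)\<^sup>2)"
      by (intro always_eventually) (simp add: abs_of_nonneg)
  qed
  have "integral\<^sup>L ?M (\<lambda>z. (g z)\<^sup>2)
      \<le> integral\<^sup>L ?M (\<lambda>z. (1 + \<epsilon>) * (h z)\<^sup>2 + (1 + 1 / \<epsilon>) * (g z - h z)\<^sup>2)"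
  proof (intro integral_mono Bochner_Integration.integrable_add integrable_mult_right i id)
    show "(g z)\<^sup>2 \<le> (1 + \<epsilon>) * (h z)\<^sup>2 + (1 + 1 / \<epsilon>) * (g z - h z)\<^sup>2" for z
      using square_sum_weighted_le[OF assms(3), of "h z" "g z - h z"] by simp
  qed
  also have "\<dots> = (1 + \<epsilon>) * integral\<^sup>L ?M (\<lambda>z. (h z)\<^sup>2) + (1 + 1 / \<epsilon>) * integral\<^sup>L ?M (\<lambda>z. (g z - h z)\<^sup>2)"
    using i id by simp
  finally show ?thesis .
qed

theorem mainTheorem6:
  fixes a b c d t :: real
    and f0 :: "real \<times> real \<Rightarrow> real"
    and f :: "real \<Rightarrow> real \<times> real \<Rightarrow> real"
  assumes "a < b" and "c < d"
    and "in_L2 (rect a b c d) f0"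
    and "truncated_kolmogorov_solution a b c d f0 f"
    and "t > 0"
  shows "norm_L2 (rect a b c d) (f t)
           \<le> exp (- (2 * t / (measure lborel {a<..<b})\<^sup>2)) * norm_L2 (rect a b c d) f0"
proof -
  let ?R = "rect a b c d"
  let ?k = "4 / (b - a)\<^sup>2"
  define N where "N = (\<lambda>g :: real \<times> real \<Rightarrow> real. integral\<^sup>L (lebesgue_on ?R) (\<lambda>z. (g z)\<^sup>2))"
  have keq: "kolmogorov_eq_on ?R f" and zb: "zero_boundary a b c d f"
    and f0: "\<And>z. z \<in> ?R \<Longrightarrow> f 0 z = f0 z" and L2: "\<And>\<tau>. \<tau> \<ge> 0 \<Longrightarrow> in_L2 ?R (f \<tau>)"
    and lim: "((\<lambda>\<tau>. norm_L2 ?R (\<lambda>z. f \<tau> z - f 0 z)) \<longlongrightarrow> 0) (at_right 0)"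
    using assms(4) by (auto simp: truncated_kolmogorov_solution_def initial_value_def)
  have N_nonneg: "N g \<ge> 0" for g by (simp add: N_def)
  have norm: "norm_L2 ?R g = sqrt (N g)" for g by (simp add: N_def norm_L2_def)
  have "((\<lambda>\<tau>. (norm_L2 ?R (\<lambda>z. f \<tau> z - f 0 z))\<^sup>2) \<longlongrightarrow> 0\<^sup>2) (at_right 0)"
    by (intro tendsto_power lim)
  then have limN: "((\<lambda>\<tau>. N (\<lambda>z. f \<tau> z - f 0 z)) \<longlongrightarrow> 0) (at_right 0)"
    by (simp add: norm N_nonneg)
  have weighted: "N (f t) \<le> exp (- (?k * t)) * ((1 + \<epsilon>) * N (f 0))" if \<epsilon>: "\<epsilon> > 0" for \<epsilon>
  proof (rule tendsto_lowerbound)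
    show "((\<lambda>s. exp (- (?k * (t - s))) * ((1 + \<epsilon>) * N (f 0) + (1 + 1 / \<epsilon>) * N (\<lambda>z. f s z - f 0 z)))
      \<longlongrightarrow> exp (- (?k * t)) * ((1 + \<epsilon>) * N (f 0))) (at_right 0)"
      by (rule tendsto_eq_intros limN refl | simp)+
    have "\<forall>\<^sub>F s in at_right 0. s \<in> {0<..<t}"
      using assms(5) eventually_at_right_real by blast
    then show "\<forall>\<^sub>F s in at_right 0.
      N (f t) \<le> exp (- (?k * (t - s))) * ((1 + \<epsilon>) * N (f 0) + (1 + 1 / \<epsilon>) * N (\<lambda>z. f s z - f 0 z))"
    proof eventually_elim
      case (elim s)
      have "N (f t) \<le> exp (- (?k * (t - s))) * N (f s)"
        unfolding N_def using elim
        by (intro energy_decay_positive_times assms keq zb L2) auto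
      also have "\<dots> \<le> exp (- (?k * (t - s)))
          * ((1 + \<epsilon>) * N (f 0) + (1 + 1 / \<epsilon>) * N (\<lambda>z. f s z - f 0 z))"
        unfolding N_def using elim
        by (intro mult_left_mono L2_energy_weighted_le L2 \<epsilon>) auto
      finally show ?case .
    qed
  qed simp
  have "N (f t) \<le> exp (- (?k * t)) * N (f 0)"
  proof (rule tendsto_lowerbound)
    show "((\<lambda>\<epsilon>. exp (- (?k * t)) * ((1 + \<epsilon>) * N (f 0))) \<longlongrightarrow> exp (- (?k * t)) * N (f 0)) (at_right 0)"
      by (auto intro!: tendsto_eq_intros)
    show "\<forall>\<^sub>F \<epsilon> in at_right 0. N (f t) \<le> exp (- (?k * t)) * ((1 + \<epsilon>) * N (f 0))"
      using eventually_at_right_less by eventually_elim (rule weighted)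
  qed simp
  also have "N (f 0) = N f0"
    unfolding N_def by (intro Bochner_Integration.integral_cong) (auto simp: f0)
  also have "exp (- (?k * t)) = (exp (- (2 * t / (b - a)\<^sup>2)))\<^sup>2"
    by (simp add: exp_double[symmetric])
  finally have "sqrt (N (f t)) \<le> sqrt ((exp (- (2 * t / (b - a)\<^sup>2)))\<^sup>2 * N f0)"
    by (rule real_sqrt_le_mono)
  then show ?thesis
    using assms(1) by (simp add: norm real_sqrt_mult)
qed

end
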